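(* For each positive integer $n$, there is a (finite non-commutative) completely simple semigroup whose commuting graph has chromatic number equal to $n$.
   Context: The center of a semigroup $S$ is $Z(S)=\{x\in S: xy=yx\text{ for all }y\in S\}$. For a finite non-commutative semigroup $S$, the commuting graph $\mathcal{G}(S)$ is the simple graph with vertex set $S\setminus Z(S)$ in which two distinct vertices $x,y$ are adjacent if and only if $xy=yx$. A semigroup without a zero is completely simple if it contains no proper ideals and it contains a minimal idempotent (minimal for the partial order on idempotents given by $e\leqslant f$ if and only if $ef=fe=e$). *)

theory Defs
  imports "Graph_Theory.Pair_Digraph"
begin

locale semigroup_on =
  fixes S :: "'a set" and mul :: "'a \<Rightarrow> 'a \<Rightarrow> 'a"
  assumes nonempty: "S \<noteq> {}"
    and closed: "\<lbrakk>x \<in> S; y \<in> S\<rbrakk> \<Longrightarrow> mul x y \<in> S"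
    and assoc: "\<lbrakk>x \<in> S; y \<in> S; z \<in> S\<rbrakk> \<Longrightarrow> mul (mul x y) z = mul x (mul y z)"

definition commutative_on :: "'a set \<Rightarrow> ('a \<Rightarrow> 'a \<Rightarrow> 'a) \<Rightarrow> bool" where
  "commutative_on S mul \<longleftrightarrow> (\<forall>x\<in>S. \<forall>y\<in>S. mul x y = mul y x)"

definition center :: "'a set \<Rightarrow> ('a \<Rightarrow> 'a \<Rightarrow> 'a) \<Rightarrow> 'a set" where
  "center S mul = {x \<in> S. \<forall>y\<in>S. mul x y = mul y x}"

definition is_zero :: "'a set \<Rightarrow> ('a \<Rightarrow> 'a \<Rightarrow> 'a) \<Rightarrow> 'a \<Rightarrow> bool" where
  "is_zero S mul z \<longleftrightarrow> z \<in> S \<and> (\<forall>x\<in>S. mul z x = z \<and> mul x z = z)"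

text \<open>Ideals are nonempty, as usual in semigroup theory; otherwise the empty set
  would be a proper ideal of every semigroup.\<close>

definition semigroup_ideal :: "'a set \<Rightarrow> ('a \<Rightarrow> 'a \<Rightarrow> 'a) \<Rightarrow> 'a set \<Rightarrow> bool" where
  "semigroup_ideal S mul I \<longleftrightarrow>
     I \<noteq> {} \<and> I \<subseteq> S \<and> (\<forall>i\<in>I. \<forall>s\<in>S. mul s i \<in> I \<and> mul i s \<in> I)"

definition idempotents :: "'a set \<Rightarrow> ('a \<Rightarrow> 'a \<Rightarrow> 'a) \<Rightarrow> 'a set" where
  "idempotents S mul = {e \<in> S. mul e e = e}"

definition idem_le :: "('a \<Rightarrow> 'a \<Rightarrow> 'a) \<Rightarrow> 'a \<Rightarrow> 'a \<Rightarrow> bool" where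
  "idem_le mul e f \<longleftrightarrow> mul e f = e \<and> mul f e = e"

definition minimal_idempotent :: "'a set \<Rightarrow> ('a \<Rightarrow> 'a \<Rightarrow> 'a) \<Rightarrow> 'a \<Rightarrow> bool" where
  "minimal_idempotent S mul e \<longleftrightarrow>
     e \<in> idempotents S mul \<and> (\<forall>f\<in>idempotents S mul. idem_le mul f e \<longrightarrow> f = e)"

locale completely_simple_semigroup = semigroup_on +
  assumes no_zero: "\<nexists>z. is_zero S mul z"
    and no_proper_ideal: "\<not> (\<exists>I. semigroup_ideal S mul I \<and> I \<noteq> S)"
    and ex_minimal_idempotent: "\<exists>e. minimal_idempotent S mul e"

text \<open>Simple graphs are \<^locale>\<open>pair_graph\<close>s: each edge is represented by its two
  opposite arcs, and there are no loops.\<close>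

definition commuting_graph :: "'a set \<Rightarrow> ('a \<Rightarrow> 'a \<Rightarrow> 'a) \<Rightarrow> 'a pair_pre_digraph" where
  "commuting_graph S mul =
     \<lparr> pverts = S - center S mul,
       parcs = {(x, y). x \<in> S - center S mul \<and> y \<in> S - center S mul \<and>
                        x \<noteq> y \<and> mul x y = mul y x} \<rparr>"

lemma pair_graph_commuting_graph:
  assumes "finite S"
  shows "pair_graph (commuting_graph S mul)"
proof
  show "finite (parcs (commuting_graph S mul))"
    by (rule finite_subset[of _ "S \<times> S"]) (use assms in \<open>auto simp: commuting_graph_def\<close>)
qed (use assms in \<open>auto simp: commuting_graph_def symmetric_def intro!: symI\<close>)

definition colourable :: "'a pair_pre_digraph \<Rightarrow> nat \<Rightarrow> bool" where
  "colourable G k \<longleftrightarrow>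
     (\<exists>c :: 'a \<Rightarrow> nat. c ` pverts G \<subseteq> {..<k} \<and> (\<forall>(u, v)\<in>parcs G. c u \<noteq> c v))"

text \<open>Only meaningful for graphs that have some finite colouring, in particular
  for finite simple graphs.\<close>

definition chromatic_number :: "'a pair_pre_digraph \<Rightarrow> nat" where
  "chromatic_number G = (LEAST k. colourable G k)"

lemma colourable_card_verts:
  assumes "pair_graph G"
  shows "colourable G (card (pverts G))"
proof -
  interpret pair_graph G by fact
  obtain c where c: "bij_betw c (pverts G) {0..<card (pverts G)}"
    using ex_bij_betw_finite_nat[OF pair_finite_verts] by blast
  have "c u \<noteq> c v" if "(u, v) \<in> parcs G" for u v
    using c that in_arcsD1[OF that] in_arcsD2[OF that] pair_no_loops[OF that]
    by (auto simp: bij_betw_def dest: inj_onD)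
  with c show ?thesis
    by (auto simp: colourable_def bij_betw_def lessThan_atLeast0 intro!: exI[of _ c])
qed

end

theory Submission
  imports Defs
begin

text \<open>
  The semigroup is the direct product of the left zero band \<open>{0, 1}\<close> with the cyclic group
  of order \<open>n\<close>, that is, \<open>(i, g) (j, h) = (i, g + h)\<close>. As the group is abelian, two elements
  commute precisely when their band coordinates agree. Every element therefore fails to commute
  with all elements of the other block, so the centre is empty, and the commuting graph
  consists of two disjoint complete graphs on \<open>n\<close> vertices, one for each block. Colouring an
  element by its group coordinate is proper and uses \<open>n\<close> colours; either block is a clique
  that forces as many.

  The product is completely simple: from any element \<open>(j, h)\<close> one reaches any other
  \<open>(i, g)\<close> by the left multiplication \<open>(i, g - h) (j, h) = (i, g)\<close>, so there is no proper ideal,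
  and \<open>(0, 0)\<close> is a minimal idempotent. A zero would be central, so there is none.

  The pair \<open>(i, g)\<close> is coded by the number \<open>n * i + g\<close>: division by \<open>n\<close> recovers the band
  coordinate as quotient and the group coordinate as remainder.
\<close>

definition band_cyclic_mult :: "nat \<Rightarrow> nat \<Rightarrow> nat \<Rightarrow> nat" where
  "band_cyclic_mult n x y = n * (x div n) + (x + y) mod n"

lemma band_cyclic_mult_div [simp]: "n > 0 \<Longrightarrow> band_cyclic_mult n x y div n = x div n"
  by (simp add: band_cyclic_mult_def)

lemma band_cyclic_mult_mod [simp]: "band_cyclic_mult n x y mod n = (x + y) mod n"
  by (simp add: band_cyclic_mult_def)

lemma eq_iff_div_mod_eq: "x = y \<longleftrightarrow> x div n = y div n \<and> x mod n = y mod n" for n :: nat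
  by (metis div_mult_mod_eq)

lemma in_blocks_iff: "n > 0 \<Longrightarrow> x \<in> {..<2 * n} \<longleftrightarrow> x div n < 2" for n :: nat
  by (simp add: div_less_iff_less_mult)

lemma band_cyclic_commute_iff:
  assumes "n > 0"
  shows "band_cyclic_mult n x y = band_cyclic_mult n y x \<longleftrightarrow> x div n = y div n"
  using assms by (subst eq_iff_div_mod_eq[of _ _ n]) (simp add: add.commute)

lemma center_band_cyclic:
  assumes "n > 0"
  shows "center {..<2 * n} (band_cyclic_mult n) = {}"
proof -
  have "\<exists>y\<in>{..<2 * n}. x div n \<noteq> y div n" for x
  proof (cases "x div n = 0")
    case True
    with assms show ?thesis by (intro bexI[of _ n]) auto
  next
    case False
    with assms show ?thesis by (intro bexI[of _ 0]) auto
  qed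
  with assms show ?thesis
    by (auto simp: center_def band_cyclic_commute_iff)
qed

lemma not_commutative_if_center_empty:
  "S \<noteq> {} \<Longrightarrow> center S mul = {} \<Longrightarrow> \<not> commutative_on S mul"
  by (auto simp: center_def commutative_on_def)

lemma zero_in_center: "is_zero S mul z \<Longrightarrow> z \<in> center S mul"
  by (simp add: center_def is_zero_def)

lemma ideal_eq_if_left_translates:
  assumes ideal: "semigroup_ideal S mul I"
    and translates: "\<And>i s. i \<in> S \<Longrightarrow> s \<in> S \<Longrightarrow> \<exists>t\<in>S. mul t i = s"
  shows "I = S"
proof
  show "I \<subseteq> S"
    using ideal by (simp add: semigroup_ideal_def)
  show "S \<subseteq> I"
  proof
    fix s assume "s \<in> S"
    obtain i where "i \<in> I"
      using ideal by (auto simp: semigroup_ideal_def)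
    moreover from this obtain t where "t \<in> S" "mul t i = s"
      using translates \<open>I \<subseteq> S\<close> \<open>s \<in> S\<close> by (meson subsetD)
    ultimately show "s \<in> I"
      using ideal unfolding semigroup_ideal_def by metis
  qed
qed

lemma left_translate_band_cyclic:
  assumes "n > 0" "s \<in> {..<2 * n}"
  shows "\<exists>t\<in>{..<2 * n}. band_cyclic_mult n t i = s"
proof
  \<comment> \<open>The band coordinate of \<open>s\<close> with the group coordinate of \<open>s\<close> minus that of \<open>i\<close>.\<close>
  let ?t = "band_cyclic_mult n s (n - i mod n)"
  show "?t \<in> {..<2 * n}"
    using assms by (simp only: in_blocks_iff band_cyclic_mult_div)
  have "(s + (n - i mod n) + i) mod n = (s + (n - i mod n + i mod n)) mod n"
    by (metis add.assoc mod_add_right_eq)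
  also have "n - i mod n + i mod n = n"
    using assms by (simp add: less_imp_le)
  also have "(s + n) mod n = s mod n"
    by simp
  finally have "(s + (n - i mod n) + i) mod n = s mod n" .
  moreover have "(?t + i) mod n = (s + (n - i mod n) + i) mod n"
    by (metis band_cyclic_mult_mod mod_add_left_eq)
  ultimately show "band_cyclic_mult n ?t i = s"
    using assms by (subst eq_iff_div_mod_eq[of _ s n]) simp
qed

lemma minimal_idempotent_band_cyclic:
  assumes "n > 0"
  shows "minimal_idempotent {..<2 * n} (band_cyclic_mult n) 0"
proof -
  have unique: "f = 0"
    if idem: "band_cyclic_mult n f f = f" and le: "band_cyclic_mult n 0 f = f" for f
  proof -
    have "f div n = 0"
      using band_cyclic_mult_div[OF assms, of 0 f] by (simp add: le)
    then have "f < n"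
      using assms by (simp add: div_eq_0_iff)
    moreover have "(f + f) mod n = f mod n"
      using band_cyclic_mult_mod[of n f f] unfolding idem ..
    then have "n dvd f"
      using mod_eq_dvd_iff_nat[of f "f + f" n] by simp
    ultimately show "f = 0"
      by (meson gr0I nat_dvd_not_less)
  qed
  have "0 \<in> idempotents {..<2 * n} (band_cyclic_mult n)"
    using assms by (simp add: idempotents_def band_cyclic_mult_def)
  then show ?thesis
    unfolding minimal_idempotent_def idem_le_def idempotents_def using unique by blast
qed

lemma completely_simple_band_cyclic:
  assumes "n > 0"
  shows "completely_simple_semigroup {..<2 * n} (band_cyclic_mult n)"
proof
  show "{..<2 * n} \<noteq> {}"
    using assms by (simp add: lessThan_empty_iff)
  show "band_cyclic_mult n x y \<in> {..<2 * n}" if "x \<in> {..<2 * n}" for x y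
    using assms that by (simp only: in_blocks_iff band_cyclic_mult_div)
  show "band_cyclic_mult n (band_cyclic_mult n x y) z
      = band_cyclic_mult n x (band_cyclic_mult n y z)" for x y z
  proof -
    have "(band_cyclic_mult n x y + z) mod n = (x + y + z) mod n"
      by (metis band_cyclic_mult_mod mod_add_left_eq)
    moreover have "(x + band_cyclic_mult n y z) mod n = (x + (y + z)) mod n"
      by (metis band_cyclic_mult_mod mod_add_right_eq)
    ultimately show ?thesis
      using assms by (subst eq_iff_div_mod_eq[of _ _ n]) (simp add: add.assoc)
  qed
  show "\<nexists>z. is_zero {..<2 * n} (band_cyclic_mult n) z"
  proof (rule notI, elim exE)
    fix z assume "is_zero {..<2 * n} (band_cyclic_mult n) z"
    from zero_in_center[OF this] show False
      unfolding center_band_cyclic[OF assms] ..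
  qed
  show "\<not> (\<exists>I. semigroup_ideal {..<2 * n} (band_cyclic_mult n) I \<and> I \<noteq> {..<2 * n})"
  proof (rule notI, elim exE conjE)
    fix I assume "semigroup_ideal {..<2 * n} (band_cyclic_mult n) I" "I \<noteq> {..<2 * n}"
    then show False
      using ideal_eq_if_left_translates[OF _ left_translate_band_cyclic[OF assms]] by simp
  qed
  show "\<exists>e. minimal_idempotent {..<2 * n} (band_cyclic_mult n) e"
    using minimal_idempotent_band_cyclic[OF assms] ..
qed

lemma card_clique_le_colours:
  assumes "colourable G k" "K \<subseteq> pverts G"
    and clique: "\<And>u v. u \<in> K \<Longrightarrow> v \<in> K \<Longrightarrow> u \<noteq> v \<Longrightarrow> (u, v) \<in> parcs G"
  shows "card K \<le> k"
proof -
  obtain c where c: "c ` pverts G \<subseteq> {..<k}" "\<forall>(u, v)\<in>parcs G. c u \<noteq> c v"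
    using assms(1) by (auto simp: colourable_def)
  have "inj_on c K"
    using c(2) clique by (fastforce intro: inj_onI)
  moreover have "c ` K \<subseteq> {..<k}"
    using c(1) assms(2) by blast
  ultimately show ?thesis
    using card_inj_on_le[of c K "{..<k}"] by simp
qed

lemma chromatic_number_band_cyclic:
  assumes "n > 0"
  shows "chromatic_number (commuting_graph {..<2 * n} (band_cyclic_mult n)) = n"
    (is "chromatic_number ?G = n")
  unfolding chromatic_number_def
proof (rule Least_equality)
  have verts: "pverts ?G = {..<2 * n}"
    using assms by (simp add: commuting_graph_def center_band_cyclic)
  have arcs: "(x, y) \<in> parcs ?G \<longleftrightarrow>
      x \<in> {..<2 * n} \<and> y \<in> {..<2 * n} \<and> x \<noteq> y \<and> x div n = y div n" for x y
    using assms by (simp add: commuting_graph_def center_band_cyclic band_cyclic_commute_iff)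
  have "x mod n \<noteq> y mod n" if "(x, y) \<in> parcs ?G" for x y
    using that arcs eq_iff_div_mod_eq[of x y n] by blast
  then show "colourable ?G n"
    using assms by (auto simp: colourable_def intro!: exI[of _ "\<lambda>x. x mod n"])
  \<comment> \<open>The block with band coordinate \<open>0\<close> is the clique \<open>{..<n}\<close>.\<close>
  show "n \<le> k" if "colourable ?G k" for k
    using card_clique_le_colours[OF that, of "{..<n}"] by (auto simp: verts arcs)
qed

theorem corollary4p4:
  fixes n :: nat
  assumes "n > 0"
  shows "\<exists>(S :: nat set) mul.
           finite S \<and> \<not> commutative_on S mul \<and> completely_simple_semigroup S mul \<and>
           chromatic_number (commuting_graph S mul) = n"
proof (intro exI conjI)
  show "finite {..<2 * n}"
    by simp
  show "\<not> commutative_on {..<2 * n} (band_cyclic_mult n)"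
    using assms by (intro not_commutative_if_center_empty center_band_cyclic)
      (simp_all add: lessThan_empty_iff)
  show "completely_simple_semigroup {..<2 * n} (band_cyclic_mult n)"
    using assms by (rule completely_simple_band_cyclic)
  show "chromatic_number (commuting_graph {..<2 * n} (band_cyclic_mult n)) = n"
    using assms by (rule chromatic_number_band_cyclic)
qed

end
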